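(* For a sign $\varepsilon=\pm1$, let $\mathcal{S}_\pm=(\mathbb{R}^3,g_\pm)$ be the Lorentz manifold with coordinates $(x,y,\tilde x)$ on $\mathbb{R}^3$ whose metric has as its only non-zero components (up to symmetry) $$g_\pm(\partial_x,\partial_x)=-\varepsilon y^2,\qquad g_\pm(\partial_x,\partial_{\tilde x})=g_\pm(\partial_y,\partial_y)=1,$$ with $\varepsilon=+1$ for $\mathcal{S}_+$ and $\varepsilon=-1$ for $\mathcal{S}_-$. Then: (1) The manifolds $\mathcal{S}_+$ and $\mathcal{S}_-$ are geodesically complete. (2) The exponential map $\exp_P$ of $\mathcal{S}_+$ is not surjective for any point $P\in\mathbb{R}^3$. (3) The exponential map $\exp_P$ of $\mathcal{S}_-$ is a global diffeomorphism from $T_P\mathbb{R}^3$ to $\mathbb{R}^3$ for every $P\in\mathbb{R}^3$.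
   Context: Geodesics and the exponential map $\exp_P$ are those of the Levi-Civita connection. A manifold is geodesically complete if all geodesics extend for infinite time (are defined on all of $\mathbb{R}$). *)

theory Defs
  imports "HOL-Analysis.Analysis"
begin

section \<open>Smooth maps and diffeomorphisms\<close>

text \<open>Both notions are meant for open sets \<open>S\<close>. A map is \<open>C\<^sup>n\<^sup>+\<^sup>1\<close> iff it is Frechet
  differentiable and all its directional derivatives are \<open>C\<^sup>n\<close>; on Euclidean spaces this is
  the usual notion.\<close>

primrec Ck_on :: "nat \<Rightarrow> 'a::euclidean_space set \<Rightarrow> ('a \<Rightarrow> 'b::euclidean_space) \<Rightarrow> bool" where
  "Ck_on 0 S f \<longleftrightarrow> continuous_on S f"
| "Ck_on (Suc n) S f \<longleftrightarrow>
     (\<forall>x\<in>S. f differentiable (at x)) \<and> (\<forall>v. Ck_on n S (\<lambda>x. frechet_derivative f (at x) v))"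

definition smooth_on :: "'a::euclidean_space set \<Rightarrow> ('a \<Rightarrow> 'b::euclidean_space) \<Rightarrow> bool" where
  "smooth_on S f \<longleftrightarrow> (\<forall>n. Ck_on n S f)"

definition diffeomorphism :: "'a::euclidean_space set \<Rightarrow> 'b::euclidean_space set \<Rightarrow> ('a \<Rightarrow> 'b) \<Rightarrow> bool"
  where "diffeomorphism S T f \<longleftrightarrow>
    open S \<and> open T \<and> bij_betw f S T \<and> smooth_on S f \<and> smooth_on T (inv_into S f)"


section \<open>Pseudo-Riemannian metrics on \<open>\<real>\<^sup>n\<close> in the standard global chart\<close>

text \<open>A metric is given by its component matrices: \<open>g p $ i $ j\<close> is
  \<open>g(\<partial>\<^sub>i, \<partial>\<^sub>j)\<close> at the point \<open>p\<close>. All tangent spaces are identified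
  with \<open>\<real>\<^sup>n\<close> through the coordinate frame.\<close>

type_synonym 'n metric = "(real, 'n) vec \<Rightarrow> ((real, 'n) vec, 'n) vec"

definition partial_deriv :: "'n::finite \<Rightarrow> (real ^ 'n \<Rightarrow> real) \<Rightarrow> real ^ 'n \<Rightarrow> real" where
  "partial_deriv i f p = frechet_derivative f (at p) (axis i 1)"

text \<open>Signature \<open>(-,+,\<dots>,+)\<close>: some basis (the columns of \<open>A\<close>) is orthonormal, with exactly
  one timelike vector.\<close>

definition lorentz_metric :: "'n::finite metric \<Rightarrow> bool" where
  "lorentz_metric g \<longleftrightarrow> smooth_on UNIV g \<and> (\<forall>p. transpose (g p) = g p) \<and>
    (\<forall>p. \<exists>(A :: real ^ 'n ^ 'n) k. invertible A \<and>
       transpose A ** g p ** A = (\<chi> i j. if i \<noteq> j then 0 else if i = k then -1 else 1))"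

text \<open>\<open>christoffel g p k i j\<close> is the coefficient \<open>\<Gamma>\<^sup>k\<^sub>i\<^sub>j\<close> of the Levi-Civita connection,
  i.e. \<open>\<nabla>\<close> of \<open>\<partial>\<^sub>j\<close> along \<open>\<partial>\<^sub>i\<close> is the sum over \<open>k\<close> of
  \<open>\<Gamma>\<^sup>k\<^sub>i\<^sub>j \<partial>\<^sub>k\<close>.\<close>

definition christoffel :: "'n::finite metric \<Rightarrow> real ^ 'n \<Rightarrow> 'n \<Rightarrow> 'n \<Rightarrow> 'n \<Rightarrow> real" where
  "christoffel g p k i j = (1/2) * (\<Sum>l\<in>UNIV. matrix_inv (g p) $ k $ l *
     (partial_deriv i (\<lambda>q. g q $ j $ l) p + partial_deriv j (\<lambda>q. g q $ i $ l) p
      - partial_deriv l (\<lambda>q. g q $ i $ j) p))"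

lemma matrix_inv_props:
  fixes M :: "real ^ 'n::finite ^ 'n"
  assumes "invertible M"
  shows "M ** matrix_inv M = mat 1" "matrix_inv M ** M = mat 1"
  using someI_ex[OF assms[unfolded invertible_def]] unfolding matrix_inv_def by auto

lemma matrix_inv_left_entry:
  fixes M :: "real ^ 'n::finite ^ 'n"
  assumes "invertible M"
  shows "(\<Sum>l\<in>UNIV. matrix_inv M $ k $ l * M $ l $ m) = (if k = m then 1 else 0)"
proof -
  have "(matrix_inv M ** M) $ k $ m = mat 1 $ k $ m"
    using assms by (simp add: matrix_inv_props)
  then show ?thesis by (simp add: matrix_matrix_mult_def mat_def)
qed

lemma matrix_inv_right_entry:
  fixes M :: "real ^ 'n::finite ^ 'n"
  assumes "invertible M"
  shows "(\<Sum>l\<in>UNIV. M $ m $ l * matrix_inv M $ l $ k) = (if m = k then 1 else 0)"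
proof -
  have "(M ** matrix_inv M) $ m $ k = mat 1 $ m $ k"
    using assms by (simp add: matrix_inv_props)
  then show ?thesis by (simp add: matrix_matrix_mult_def mat_def)
qed

text \<open>The Christoffel symbols are the coefficients of the unique connection that is torsion-free
  and compatible with the metric.\<close>

lemma levi_civita_christoffel:
  fixes g :: "'n::finite metric"
  assumes sym: "\<And>p. transpose (g p) = g p" and inv: "\<And>p. invertible (g p)"
  shows "\<Gamma> = christoffel g \<longleftrightarrow>
    (\<forall>p k i j. \<Gamma> p k i j = \<Gamma> p k j i) \<and>
    (\<forall>p k i j. partial_deriv k (\<lambda>q. g q $ i $ j) p =
       (\<Sum>l\<in>UNIV. \<Gamma> p l k i * g p $ l $ j) + (\<Sum>l\<in>UNIV. \<Gamma> p l k j * g p $ i $ l))"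
    (is "?L \<longleftrightarrow> ?T \<and> ?C")
proof
  have gs: "g q $ i $ j = g q $ j $ i" for q i j
    by (metis sym transpose_def vec_lambda_beta)
  have lower: "(\<Sum>l\<in>UNIV. christoffel g p l i j * g p $ l $ m) = (1/2) *
     (partial_deriv i (\<lambda>q. g q $ j $ m) p + partial_deriv j (\<lambda>q. g q $ i $ m) p
      - partial_deriv m (\<lambda>q. g q $ i $ j) p)" (is "_ = (1/2) * ?D m") for p i j m
  proof -
    have "(\<Sum>l\<in>UNIV. christoffel g p l i j * g p $ l $ m) =
      (\<Sum>l\<in>UNIV. \<Sum>r\<in>UNIV. (1/2) * ?D r * (g p $ m $ l * matrix_inv (g p) $ l $ r))"
      unfolding christoffel_def
      by (simp add: sum_distrib_left sum_distrib_right gs[of p _ m] mult_ac)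
    also have "\<dots> = (\<Sum>r\<in>UNIV. (1/2) * ?D r * (\<Sum>l\<in>UNIV. g p $ m $ l * matrix_inv (g p) $ l $ r))"
      by (subst sum.swap) (simp add: sum_distrib_left)
    also have "\<dots> = (\<Sum>r\<in>UNIV. if m = r then (1/2) * ?D r else 0)"
      by (intro sum.cong refl) (simp add: matrix_inv_right_entry[OF inv])
    also have "\<dots> = (1/2) * ?D m" by simp
    finally show ?thesis .
  qed
  { assume L: ?L
    have ?T unfolding L christoffel_def
      by (auto simp: gs add.commute intro!: sum.cong)
    moreover have ?C
    proof (intro allI)
      fix p k i j
      have "(\<Sum>l\<in>UNIV. \<Gamma> p l k j * g p $ i $ l) = (\<Sum>l\<in>UNIV. christoffel g p l k j * g p $ l $ i)"
        using L by (simp add: gs[of p i])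
      then show "partial_deriv k (\<lambda>q. g q $ i $ j) p =
        (\<Sum>l\<in>UNIV. \<Gamma> p l k i * g p $ l $ j) + (\<Sum>l\<in>UNIV. \<Gamma> p l k j * g p $ i $ l)"
        using L by (simp add: lower gs[of _ j i] field_simps)
    qed
    ultimately show "?T \<and> ?C" .. }
  { assume TC: "?T \<and> ?C"
    show ?L
    proof (intro ext)
      fix p k i j
      define B where "B a b c = (\<Sum>l\<in>UNIV. \<Gamma> p l a b * g p $ l $ c)" for a b c
      have Bsym: "B a b c = B b a c" for a b c
        unfolding B_def using TC by (metis (no_types, lifting))
      have Bc: "partial_deriv c (\<lambda>q. g q $ a $ b) p = B c a b + B c b a" for a b c
        using TC by (simp add: B_def gs[of p a])
      have D: "partial_deriv i (\<lambda>q. g q $ j $ m) p + partial_deriv j (\<lambda>q. g q $ i $ m) p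
          - partial_deriv m (\<lambda>q. g q $ i $ j) p = 2 * B i j m" for m
        using Bsym[of j i m] Bsym[of i m j] Bsym[of j m i] by (simp add: Bc)
      have "christoffel g p k i j = (\<Sum>m\<in>UNIV. matrix_inv (g p) $ k $ m * B i j m)"
        unfolding christoffel_def D by (simp add: sum_distrib_left)
      also have "\<dots> = (\<Sum>m\<in>UNIV. \<Sum>l\<in>UNIV.
          \<Gamma> p l i j * (matrix_inv (g p) $ k $ m * g p $ m $ l))"
        unfolding B_def sum_distrib_left
        by (intro sum.cong refl) (metis gs mult.left_commute)
      also have "\<dots> = (\<Sum>l\<in>UNIV. \<Gamma> p l i j * (\<Sum>m\<in>UNIV. matrix_inv (g p) $ k $ m * g p $ m $ l))"
        unfolding sum_distrib_left by (rule sum.swap)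
      also have "\<dots> = (\<Sum>l\<in>UNIV. if k = l then \<Gamma> p l i j else 0)"
        by (intro sum.cong refl) (simp add: matrix_inv_left_entry[OF inv])
      finally show "\<Gamma> p k i j = christoffel g p k i j" by simp
    qed }
qed


section \<open>Geodesics and the exponential map\<close>

text \<open>\<open>\<gamma>\<close> is an affinely parametrised geodesic on the nonempty open interval \<open>I\<close>
  with velocity field \<open>\<gamma>'\<close>: the covariant derivative of \<open>\<gamma>'\<close> along \<open>\<gamma>\<close> vanishes. Values
  of \<open>\<gamma>\<close> outside \<open>I\<close> are irrelevant.\<close>

definition is_geodesic ::
  "'n::finite metric \<Rightarrow> real set \<Rightarrow> (real \<Rightarrow> real ^ 'n) \<Rightarrow> (real \<Rightarrow> real ^ 'n) \<Rightarrow> bool" where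
  "is_geodesic g I \<gamma> \<gamma>' \<longleftrightarrow> open I \<and> is_interval I \<and> I \<noteq> {} \<and>
     (\<forall>t\<in>I. (\<gamma> has_vector_derivative \<gamma>' t) (at t) \<and>
       (\<gamma>' has_vector_derivative
          (\<chi> k. - (\<Sum>i\<in>UNIV. \<Sum>j\<in>UNIV. christoffel g (\<gamma> t) k i j * \<gamma>' t $ i * \<gamma>' t $ j))) (at t))"

definition geodesically_complete :: "'n::finite metric \<Rightarrow> bool" where
  "geodesically_complete g \<longleftrightarrow> (\<forall>I \<gamma> \<gamma>'. is_geodesic g I \<gamma> \<gamma>' \<longrightarrow>
     (\<exists>\<sigma> \<sigma>'. is_geodesic g UNIV \<sigma> \<sigma>' \<and> (\<forall>t\<in>I. \<sigma> t = \<gamma> t)))"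

definition exp_rel :: "'n::finite metric \<Rightarrow> real ^ 'n \<Rightarrow> real ^ 'n \<Rightarrow> real ^ 'n \<Rightarrow> bool" where
  "exp_rel g P v Q \<longleftrightarrow> (\<exists>I \<gamma> \<gamma>'. is_geodesic g I \<gamma> \<gamma>' \<and> 0 \<in> I \<and> 1 \<in> I \<and>
     \<gamma> 0 = P \<and> \<gamma>' 0 = v \<and> \<gamma> 1 = Q)"

text \<open>The domain of the exponential map at \<open>P\<close> consists of the \<open>v\<close> whose geodesic exists up
  to time 1; \<open>exp_map g P\<close> is meaningful only there.\<close>

definition exp_domain :: "'n::finite metric \<Rightarrow> real ^ 'n \<Rightarrow> (real ^ 'n) set" where
  "exp_domain g P = {v. \<exists>Q. exp_rel g P v Q}"

definition exp_map :: "'n::finite metric \<Rightarrow> real ^ 'n \<Rightarrow> real ^ 'n \<Rightarrow> real ^ 'n" where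
  "exp_map g P v = (THE Q. exp_rel g P v Q)"


section \<open>The manifolds \<open>\<S>\<^sub>+\<close> and \<open>\<S>\<^sub>-\<close>\<close>

text \<open>The coordinates \<open>(x, y, x\<^sup>~)\<close> are the components \<open>1, 2, 3\<close> in this order.\<close>

definition S_metric :: "real \<Rightarrow> 3 metric" where
  "S_metric \<epsilon> p = vector [vector [- \<epsilon> * (p $ 2)\<^sup>2, 0, 1],
                          vector [0, 1, 0],
                          vector [1, 0, 0]]"

abbreviation S_plus :: "3 metric" where "S_plus \<equiv> S_metric 1"
abbreviation S_minus :: "3 metric" where "S_minus \<equiv> S_metric (- 1)"

lemma Ck_on_const: "Ck_on n UNIV (\<lambda>x. c)"
  by (induction n arbitrary: c) auto

lemma Ck_on_bounded_linear:
  assumes "bounded_linear f" shows "Ck_on n UNIV (\<lambda>x. f x + c)"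
proof (cases n)
  case 0
  then show ?thesis using assms
    by (simp add: continuous_on_add[OF linear_continuous_on continuous_on_const])
next
  case (Suc m)
  have d: "((\<lambda>x. f x + c) has_derivative f) (at x)" for x
    using assms by (auto intro!: derivative_eq_intros bounded_linear_imp_has_derivative)
  then have "frechet_derivative (\<lambda>x. f x + c) (at x) = f" for x
    by (metis frechet_derivative_at)
  then show ?thesis using Suc d by (auto simp: differentiable_def Ck_on_const)
qed

lemma smooth_S_metric: "smooth_on UNIV (S_metric \<epsilon>)"
  unfolding smooth_on_def
proof
  fix n
  define E :: "real ^ 3 ^ 3" where "E = axis 1 (axis 1 1)"
  define h where "h v p = (- 2 * \<epsilon> * (p $ 2) * (v $ 2)) *\<^sub>R E" for v p :: "real ^ 3"
  have S: "S_metric \<epsilon> = (\<lambda>p. (- \<epsilon> * (p $ 2)\<^sup>2) *\<^sub>R E + S_metric 0 0)"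
    by (auto simp: fun_eq_iff S_metric_def E_def vec_eq_iff forall_3 vector_3 axis_def)
  have c2: "((\<lambda>p. p $ 2) has_derivative (\<lambda>v. v $ 2)) (at p)" for p :: "real ^ 3"
    by (rule bounded_linear_imp_has_derivative[OF bounded_linear_vec_nth])
  have d: "(S_metric \<epsilon> has_derivative (\<lambda>v. h v p)) (at p)" for p
    unfolding S h_def by (auto intro!: derivative_eq_intros c2 simp: algebra_simps)
  have "bounded_linear (h v)" for v
    unfolding h_def
    by (intro bounded_linear_scaleR_const bounded_linear_mult_const bounded_linear_const_mult
        bounded_linear_vec_nth)
  from Ck_on_bounded_linear[OF this, of _ _ 0] have lin: "Ck_on m UNIV (h v)" for m v by simp
  have "frechet_derivative (S_metric \<epsilon>) (at p) = (\<lambda>v. h v p)" for p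
    using frechet_derivative_at[OF d[of p]] by simp
  moreover have "continuous_on UNIV (S_metric \<epsilon>)"
    using d by (meson continuous_at_imp_continuous_on has_derivative_continuous)
  ultimately show "Ck_on n UNIV (S_metric \<epsilon>)"
    using d lin by (cases n) (auto simp: differentiable_def)
qed

lemma lorentz_S_metric: "lorentz_metric (S_metric \<epsilon>)"
  unfolding lorentz_metric_def
proof (intro conjI allI)
  show "smooth_on UNIV (S_metric \<epsilon>)" by (rule smooth_S_metric)
next
  fix p
  show "transpose (S_metric \<epsilon> p) = S_metric \<epsilon> p"
    by (simp add: S_metric_def transpose_def vec_eq_iff forall_3 vector_3)
next
  fix p :: "real ^ 3"
  define a where "a = - \<epsilon> * (p $ 2)\<^sup>2"
  define A :: "real ^ 3 ^ 3" where
    "A = vector [vector [1, 0, 1], vector [0, 1, 0], vector [(- 1 - a) / 2, 0, (1 - a) / 2]]"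
  have S: "S_metric \<epsilon> p = vector [vector [a, 0, 1], vector [0, 1, 0], vector [1, 0, 0]]"
    by (simp add: S_metric_def a_def)
  have "det A = 1" by (simp add: det_3 A_def vector_3 field_simps)
  then have "invertible A" by (simp add: invertible_det_nz)
  moreover have "transpose A ** S_metric \<epsilon> p ** A =
      (\<chi> i j. if i \<noteq> j then 0 else if i = 1 then -1 else 1)"
    by (simp add: S A_def transpose_def matrix_matrix_mult_def
        vec_eq_iff forall_3 sum_3 vector_3 field_simps)
  ultimately show "\<exists>(A :: real ^ 3 ^ 3) k. invertible A \<and> transpose A ** S_metric \<epsilon> p ** A =
      (\<chi> i j. if i \<noteq> j then 0 else if i = k then -1 else 1)" by blast
qed

end

theory Submission
  imports Defs
begin

text \<open>
  With \<open>k = - \<epsilon> a\<^sup>2\<close>, the geodesic equations of \<open>S_metric \<epsilon>\<close> read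
  \<open>x'' = 0\<close>, \<open>y'' = - \<epsilon> x'\<^sup>2 y = k y\<close> where \<open>a = x'\<close> is constant, and
  \<open>z'' = 2 \<epsilon> x' y y'\<close> for the third coordinate \<open>z\<close>. They can be solved one after the other:
  \<open>x\<close> is affine, \<open>y\<close> solves a linear oscillator equation with constant coefficient, and the
  last equation says that \<open>z' - \<epsilon> a y\<^sup>2\<close> is constant, so \<open>z\<close> is obtained by integrating
  \<open>y\<^sup>2\<close>. If \<open>C\<close>, \<open>S\<close> are the solutions of \<open>u'' = k u\<close> with initial data \<open>(1, 0)\<close>
  and \<open>(0, 1)\<close>, and \<open>A\<close> is the integral of \<open>S\<^sup>2\<close>, this produces the closed formula
  \<open>geod\<close>. It is defined for all times (\<open>geod_is_geodesic\<close>) and every geodesic agrees with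
  it (\<open>geodesic_eq_geod\<close>), which gives completeness for every \<open>\<epsilon>\<close> and an explicit
  exponential map (\<open>exp_map_S_metric\<close>).

  For \<open>\<epsilon> = 1\<close> the oscillator is \<open>y'' = - a\<^sup>2 y\<close>. A geodesic from \<open>P\<close> reaching the plane
  \<open>x = P $ 1 + \<pi>\<close> at time 1 must have \<open>a = \<pi>\<close>, and then
  \<open>y(1) = P $ 2 * cos \<pi> + v $ 2 * sin \<pi> / \<pi> = - P $ 2\<close> regardless of \<open>v $ 2\<close>:
  all these geodesics are focused on one line and miss the rest of the plane.

  For \<open>\<epsilon> = - 1\<close> one has \<open>S(1) = sinh a / a\<close>, which never vanishes, so the triangular
  formula for the exponential map can be solved explicitly for the initial velocity. What
  remains is smoothness in \<open>a\<close>, also at \<open>a = 0\<close>, of \<open>S(1)\<close> and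
  \<open>A(1) = (sinh (2 a) - 2 a) / (4 a\<^sup>3)\<close>; both are combinations of the everywhere convergent
  power series \<open>exp_tail\<close>.
\<close>

section \<open>Smooth functions\<close>

lemma frechet_derivative_eqI: "(f has_derivative f') (at x) \<Longrightarrow> frechet_derivative f (at x) = f'"
  using frechet_derivative_at by metis

text \<open>The recursion for \<open>Ck_on\<close> speaks of the chosen derivative \<open>frechet_derivative\<close>; on all
  of space any explicit formula for the derivative may be used instead. Each closure
  property below is an induction whose step applies this to the rule of calculus in
  question.\<close>

lemma Ck_on_SucI:
  assumes "\<And>x. (f has_derivative f' x) (at x)" and "\<And>v. Ck_on n UNIV (\<lambda>x. f' x v)"
  shows "Ck_on (Suc n) UNIV f"
proof -
  have "frechet_derivative f (at x) = f' x" for x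
    using assms(1) by (rule frechet_derivative_eqI)
  then show ?thesis using assms by (auto simp: differentiable_def)
qed

lemma Ck_on_has_derivative:
  assumes "Ck_on (Suc n) UNIV f"
  shows "(f has_derivative frechet_derivative f (at x)) (at x)"
  using assms by (auto simp: frechet_derivative_works)

lemma Ck_on_Suc_imp: "Ck_on (Suc n) UNIV f \<Longrightarrow> Ck_on n UNIV f"
proof (induction n arbitrary: f)
  case 0
  then show ?case
    by (auto intro!: continuous_at_imp_continuous_on differentiable_imp_continuous_within)
qed auto

lemma Ck_on_add:
  "Ck_on n UNIV f \<Longrightarrow> Ck_on n UNIV g \<Longrightarrow> Ck_on n UNIV (\<lambda>x. f x + g x)"
proof (induction n arbitrary: f g)
  case (Suc n)
  show ?case
  proof (rule Ck_on_SucI)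
    show "((\<lambda>x. f x + g x) has_derivative
        (\<lambda>v. frechet_derivative f (at x) v + frechet_derivative g (at x) v)) (at x)" for x
      by (intro has_derivative_add Ck_on_has_derivative[OF Suc.prems(1)]
          Ck_on_has_derivative[OF Suc.prems(2)])
  qed (use Suc in auto)
qed (auto intro: continuous_on_add)

lemma Ck_on_linear_image:
  assumes "bounded_linear L"
  shows "Ck_on n UNIV f \<Longrightarrow> Ck_on n UNIV (\<lambda>x. L (f x))"
proof (induction n arbitrary: f)
  case 0
  then show ?case using bounded_linear.continuous_on[OF assms] by auto
next
  case (Suc n)
  show ?case
  proof (rule Ck_on_SucI)
    show "((\<lambda>x. L (f x)) has_derivative (\<lambda>v. L (frechet_derivative f (at x) v))) (at x)" for x
      by (intro bounded_linear.has_derivative[OF assms] Ck_on_has_derivative[OF Suc.prems])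
  qed (use Suc in auto)
qed

lemma Ck_on_mult:
  fixes f g :: "'a::euclidean_space \<Rightarrow> real"
  shows "Ck_on n UNIV f \<Longrightarrow> Ck_on n UNIV g \<Longrightarrow> Ck_on n UNIV (\<lambda>x. f x * g x)"
proof (induction n arbitrary: f g)
  case (Suc n)
  have "Ck_on n UNIV f" "Ck_on n UNIV g" using Suc.prems by (blast intro: Ck_on_Suc_imp)+
  moreover have "Ck_on n UNIV (\<lambda>x. frechet_derivative f (at x) v)"
    "Ck_on n UNIV (\<lambda>x. frechet_derivative g (at x) v)" for v
    using Suc.prems by auto
  ultimately have "Ck_on n UNIV (\<lambda>x. f x * frechet_derivative g (at x) v
      + frechet_derivative f (at x) v * g x)" for v
    by (intro Ck_on_add Suc.IH)
  moreover have "((\<lambda>x. f x * g x) has_derivative (\<lambda>v. f x * frechet_derivative g (at x) v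
      + frechet_derivative f (at x) v * g x)) (at x)" for x
    by (intro has_derivative_mult Ck_on_has_derivative[OF Suc.prems(1)]
        Ck_on_has_derivative[OF Suc.prems(2)])
  ultimately show ?case by (rule Ck_on_SucI[rotated])
qed (auto intro: continuous_on_mult)

lemma Ck_on_inverse:
  fixes f :: "'a::euclidean_space \<Rightarrow> real"
  assumes "\<And>x. f x \<noteq> 0"
  shows "Ck_on n UNIV f \<Longrightarrow> Ck_on n UNIV (\<lambda>x. inverse (f x))"
proof (induction n)
  case 0
  then show ?case using assms by (auto intro: continuous_on_inverse)
next
  case (Suc n)
  have I: "Ck_on n UNIV (\<lambda>x. inverse (f x))"
    using Suc by (blast intro: Ck_on_Suc_imp)
  show ?case
  proof (rule Ck_on_SucI)
    show "((\<lambda>x. inverse (f x)) has_derivative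
        (\<lambda>v. - (inverse (f x) * frechet_derivative f (at x) v * inverse (f x)))) (at x)" for x
      using assms Ck_on_has_derivative[OF Suc.prems] by (auto intro: has_derivative_inverse)
    show "Ck_on n UNIV (\<lambda>x. - (inverse (f x) * frechet_derivative f (at x) v * inverse (f x)))" for v
      by (rule Ck_on_linear_image[OF bounded_linear_minus[OF bounded_linear_ident]])
        (use I Suc.prems in \<open>auto intro!: Ck_on_mult\<close>)
  qed
qed

text \<open>By the chain rule, differentiating \<open>h (f x)\<close> for a power series \<open>h\<close> yields \<open>h' (f x)\<close>
  times a derivative of \<open>f\<close>. As \<open>h'\<close> is again an everywhere convergent power series, the
  induction closes once the coefficients are generalised.\<close>

lemma Ck_on_powser:
  fixes f :: "'a::euclidean_space \<Rightarrow> real"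
  assumes "\<And>x::real. summable (\<lambda>j. c j * x ^ j)"
  shows "Ck_on n UNIV f \<Longrightarrow> Ck_on n UNIV (\<lambda>x. \<Sum>j. c j * f x ^ j)"
  using assms
proof (induction n arbitrary: c)
  case 0
  have "isCont (\<lambda>x. \<Sum>j. c j * x ^ j) x" for x :: real
    using termdiffs_strong_converges_everywhere[OF "0.prems"(2)] by (rule DERIV_isCont)
  then have "continuous_on UNIV (\<lambda>x. \<Sum>j. c j * x ^ j)"
    by (auto intro: continuous_at_imp_continuous_on)
  then show ?case
    using 0 by (auto intro: continuous_on_compose2)
next
  case (Suc n)
  show ?case
  proof (rule Ck_on_SucI)
    fix x
    have "((\<lambda>x. \<Sum>j. c j * x ^ j) has_real_derivative (\<Sum>j. diffs c j * f x ^ j)) (at (f x))"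
      by (rule termdiffs_strong_converges_everywhere[OF Suc.prems(2)])
    then show "((\<lambda>x. \<Sum>j. c j * f x ^ j) has_derivative
        (\<lambda>v. (\<Sum>j. diffs c j * f x ^ j) * frechet_derivative f (at x) v)) (at x)"
      using has_derivative_compose[OF Ck_on_has_derivative[OF Suc.prems(1)]]
      by (auto simp: has_field_derivative_def)
  next
    fix v
    show "Ck_on n UNIV (\<lambda>x. (\<Sum>j. diffs c j * f x ^ j) * frechet_derivative f (at x) v)"
    proof (rule Ck_on_mult)
      show "Ck_on n UNIV (\<lambda>x. \<Sum>j. diffs c j * f x ^ j)"
        by (intro Suc.IH Ck_on_Suc_imp[OF Suc.prems(1)] termdiff_converges_all Suc.prems(2))
    qed (use Suc.prems in auto)
  qed
qed

named_theorems smooth_intros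

lemma smooth_on_const [smooth_intros]: "smooth_on UNIV (\<lambda>x. c)"
  by (simp add: smooth_on_def Ck_on_const)

lemma smooth_on_nth [smooth_intros]: "smooth_on UNIV (\<lambda>x :: real ^ 'n. x $ i)"
  by (simp add: smooth_on_def Ck_on_bounded_linear[OF bounded_linear_vec_nth, of _ _ 0, simplified])

lemma smooth_on_add [smooth_intros]:
  "smooth_on UNIV f \<Longrightarrow> smooth_on UNIV g \<Longrightarrow> smooth_on UNIV (\<lambda>x. f x + g x)"
  by (simp add: smooth_on_def Ck_on_add)

lemma smooth_on_minus [smooth_intros]:
  "smooth_on UNIV f \<Longrightarrow> smooth_on UNIV (\<lambda>x. - f x)"
  by (simp add: smooth_on_def Ck_on_linear_image[OF bounded_linear_minus[OF bounded_linear_ident]])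

lemma smooth_on_diff [smooth_intros]:
  "smooth_on UNIV f \<Longrightarrow> smooth_on UNIV g \<Longrightarrow> smooth_on UNIV (\<lambda>x. f x - g x)"
  using smooth_on_add[OF _ smooth_on_minus, of f g] by simp

lemma smooth_on_mult [smooth_intros]:
  fixes f g :: "'a::euclidean_space \<Rightarrow> real"
  shows "smooth_on UNIV f \<Longrightarrow> smooth_on UNIV g \<Longrightarrow> smooth_on UNIV (\<lambda>x. f x * g x)"
  by (simp add: smooth_on_def Ck_on_mult)

lemma smooth_on_power [smooth_intros]:
  fixes f :: "'a::euclidean_space \<Rightarrow> real"
  shows "smooth_on UNIV f \<Longrightarrow> smooth_on UNIV (\<lambda>x. f x ^ n)"
  by (induction n) (auto intro: smooth_intros)

lemma smooth_on_divide [smooth_intros]: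
  fixes f g :: "'a::euclidean_space \<Rightarrow> real"
  assumes "smooth_on UNIV f" "smooth_on UNIV g" "\<And>x. g x \<noteq> 0"
  shows "smooth_on UNIV (\<lambda>x. f x / g x)"
  using assms by (simp add: smooth_on_def divide_inverse Ck_on_mult Ck_on_inverse)

lemma smooth_on_powser:
  fixes f :: "'a::euclidean_space \<Rightarrow> real"
  assumes "\<And>x::real. summable (\<lambda>j. c j * x ^ j)" "smooth_on UNIV f"
  shows "smooth_on UNIV (\<lambda>x. \<Sum>j. c j * f x ^ j)"
  using assms by (simp add: smooth_on_def Ck_on_powser)

lemma smooth_on_vector_3 [smooth_intros]:
  fixes f g h :: "'a::euclidean_space \<Rightarrow> real"
  assumes "smooth_on UNIV f" "smooth_on UNIV g" "smooth_on UNIV h"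
  shows "smooth_on UNIV (\<lambda>x. vector [f x, g x, h x] :: real ^ 3)"
proof -
  have "smooth_on UNIV (\<lambda>x. u x *\<^sub>R w)" if "smooth_on UNIV u"
    for u :: "'a \<Rightarrow> real" and w :: "real ^ 3"
    using that by (simp add: smooth_on_def
        Ck_on_linear_image[OF bounded_linear_scaleR_const[OF bounded_linear_ident]])
  moreover have "(\<lambda>x. vector [f x, g x, h x]) =
      (\<lambda>x. f x *\<^sub>R axis 1 1 + g x *\<^sub>R axis 2 1 + h x *\<^sub>R (axis 3 1 :: real ^ 3))"
    by (auto simp: fun_eq_iff vec_eq_iff forall_3 vector_3 axis_def)
  ultimately show ?thesis using assms by (simp add: smooth_on_add)
qed

section \<open>Tails of the exponential series\<close>

text \<open>For \<open>x \<noteq> 0\<close> this is the exponential series without its first \<open>m\<close> terms, divided by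
  \<open>x ^ m\<close>. It resolves the removable singularities at \<open>a = 0\<close> in the exponential map of
  \<open>\<S>\<^sub>-\<close>.\<close>

definition exp_tail :: "nat \<Rightarrow> real \<Rightarrow> real" where
  "exp_tail m x = (\<Sum>j. inverse (fact (j + m)) * x ^ j)"

lemma summable_exp_tail: "summable (\<lambda>j. inverse (fact (j + m)) * x ^ j)" for x :: real
proof (rule summable_comparison_test'[where N = 0])
  show "summable (\<lambda>j. inverse (fact j) * \<bar>x\<bar> ^ j)" by (rule summable_exp)
  show "norm (inverse (fact (j + m)) * x ^ j) \<le> inverse (fact j) * \<bar>x\<bar> ^ j" for j
  proof -
    have "(fact j::real) \<le> fact (j + m)" by (rule fact_mono) simp
    then show ?thesis
      by (auto simp: abs_mult power_abs intro!: mult_right_mono le_imp_inverse_le)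
  qed
qed

lemma exp_tail_0: "exp_tail 0 x = exp x"
  by (simp add: exp_tail_def exp_def scaleR_conv_of_real divide_inverse mult.commute)

lemma exp_tail_Suc: "x * exp_tail (Suc m) x = exp_tail m x - 1 / fact m"
  using powser_split_head(1)[OF summable_exp_tail[of m x]]
  by (simp add: exp_tail_def divide_inverse mult.commute)

lemma exp_tail_at_0: "exp_tail m 0 = 1 / fact m"
  by (simp add: exp_tail_def powser_zero divide_inverse)

lemma smooth_on_exp_tail [smooth_intros]:
  fixes f :: "'a::euclidean_space \<Rightarrow> real"
  assumes "smooth_on UNIV f"
  shows "smooth_on UNIV (\<lambda>x. exp_tail m (f x))"
  unfolding exp_tail_def by (rule smooth_on_powser[OF summable_exp_tail assms])

lemma smooth_on_cosh [smooth_intros]: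
  fixes f :: "'a::euclidean_space \<Rightarrow> real"
  assumes "smooth_on UNIV f"
  shows "smooth_on UNIV (\<lambda>x. cosh (f x))"
proof -
  have "smooth_on UNIV (\<lambda>x. (exp_tail 0 (f x) + exp_tail 0 (- f x)) / 2)"
    by (intro smooth_intros assms) auto
  then show ?thesis by (simp add: exp_tail_0 cosh_def)
qed

text \<open>\<open>sinhc a\<close> extends \<open>sinh a / a\<close>, and \<open>sinhc_sq_int a\<close> extends
  \<open>(sinh (2 a) - 2 a) / (4 a\<^sup>3)\<close>, the integral of \<open>(sinh (a t) / a)\<^sup>2\<close> over \<open>[0, 1]\<close>.
  Writing them by \<open>exp_tail\<close> makes smoothness evident.\<close>

definition sinhc :: "real \<Rightarrow> real" where
  "sinhc a = (exp_tail 1 a + exp_tail 1 (- a)) / 2"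

definition sinhc_sq_int :: "real \<Rightarrow> real" where
  "sinhc_sq_int a = exp_tail 3 (2 * a) + exp_tail 3 (- 2 * a)"

lemma smooth_on_sinhc [smooth_intros]:
  fixes f :: "'a::euclidean_space \<Rightarrow> real"
  assumes "smooth_on UNIV f"
  shows "smooth_on UNIV (\<lambda>x. sinhc (f x))"
  unfolding sinhc_def by (intro smooth_intros assms) simp

lemma smooth_on_sinhc_sq_int [smooth_intros]:
  fixes f :: "'a::euclidean_space \<Rightarrow> real"
  assumes "smooth_on UNIV f"
  shows "smooth_on UNIV (\<lambda>x. sinhc_sq_int (f x))"
  unfolding sinhc_sq_int_def by (intro smooth_intros assms)

lemma sinhc_eq: "sinhc a = (if a = 0 then 1 else sinh a / a)"
  using exp_tail_Suc[of a 0] exp_tail_Suc[of "- a" 0]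
  by (auto simp: sinhc_def exp_tail_at_0 exp_tail_0 sinh_def field_simps)

lemma sinhc_pos: "sinhc a > 0"
  by (cases a "0::real" rule: linorder_cases)
    (auto simp: sinhc_eq divide_neg_neg)

lemma sinhc_sq_int_eq:
  "sinhc_sq_int a = (if a = 0 then 1 / 3 else (cosh a * (sinh a / a) - 1) / (2 * a\<^sup>2))"
proof (cases "a = 0")
  case True
  then show ?thesis by (simp add: sinhc_sq_int_def exp_tail_at_0 fact_numeral)
next
  case False
  have T: "x ^ 3 * exp_tail 3 x = exp x - 1 - x - x\<^sup>2 / 2" for x
  proof -
    have "x * exp_tail 1 x = exp x - 1" "x * exp_tail 2 x = exp_tail 1 x - 1"
      "x * exp_tail 3 x = exp_tail 2 x - 1 / 2"
      using exp_tail_Suc[of x 0] exp_tail_Suc[of x 1] exp_tail_Suc[of x 2]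
      by (simp_all add: exp_tail_0 numeral_2_eq_2 numeral_3_eq_3)
    then show ?thesis by algebra
  qed
  \<comment> \<open>The even powers in the two tails cancel, leaving twice the odd part of \<open>exp x - x\<close> at \<open>x = 2 a\<close>.\<close>
  have "8 * a ^ 3 * sinhc_sq_int a = exp (2 * a) - exp (- 2 * a) - 4 * a"
    using T[of "2 * a"] T[of "- 2 * a"]
    by (simp add: sinhc_sq_int_def power_mult_distrib algebra_simps)
  also have "\<dots> = 4 * sinh a * cosh a - 4 * a"
    using sinh_double[of a] by (simp add: sinh_def)
  finally show ?thesis using False
    by (simp add: field_simps power2_eq_square power3_eq_cube)
qed


section \<open>Geodesic equations\<close>

lemma vec_eq_3: "x = y \<longleftrightarrow> x $ 1 = y $ 1 \<and> x $ 2 = y $ 2 \<and> x $ 3 = y $ 3" for x y :: "'a ^ 3"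
  by (simp add: vec_eq_iff forall_3)

lemma matrix_inv_S_metric:
  "matrix_inv (S_metric \<epsilon> p) =
    vector [vector [0, 0, 1], vector [0, 1, 0], vector [1, 0, \<epsilon> * (p $ 2)\<^sup>2]]" (is "_ = ?B")
proof -
  have B: "S_metric \<epsilon> p ** ?B = mat 1" "?B ** S_metric \<epsilon> p = mat 1"
    by (simp_all add: S_metric_def matrix_matrix_mult_def vec_eq_iff forall_3 sum_3 vector_3 mat_def)
  then have "invertible (S_metric \<epsilon> p)" unfolding invertible_def by blast
  then have "matrix_inv (S_metric \<epsilon> p) ** (S_metric \<epsilon> p ** ?B) = ?B"
    by (simp add: matrix_mul_assoc matrix_inv_props)
  then show ?thesis by (simp add: B)
qed

lemma partial_deriv_const: "partial_deriv i (\<lambda>q. c) p = 0"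
  by (simp add: partial_deriv_def)

lemma partial_deriv_S_metric:
  "partial_deriv i (\<lambda>q. S_metric \<epsilon> q $ j $ l) p =
    (if i = 2 \<and> j = 1 \<and> l = 1 then - 2 * \<epsilon> * p $ 2 else 0)"
proof -
  have d: "((\<lambda>q :: real ^ 3. - (\<epsilon> * (q $ 2)\<^sup>2)) has_derivative (\<lambda>v. - (\<epsilon> * (2 * p $ 2 * v $ 2)))) (at p)"
    by (auto intro!: derivative_eq_intros bounded_linear_imp_has_derivative[OF bounded_linear_vec_nth])
  show ?thesis
    using exhaust_3[of j] exhaust_3[of l] exhaust_3[of i]
    by (auto simp: S_metric_def vector_3 partial_deriv_const)
      (auto simp: partial_deriv_def frechet_derivative_eqI[OF d] axis_def)
qed

lemma christoffel_S_metric: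
  "christoffel (S_metric \<epsilon>) p k i j =
    (if k = 2 \<and> i = 1 \<and> j = 1 then \<epsilon> * p $ 2
     else if k = 3 \<and> (i = 1 \<and> j = 2 \<or> i = 2 \<and> j = 1) then - \<epsilon> * p $ 2 else 0)"
  unfolding christoffel_def matrix_inv_S_metric partial_deriv_S_metric sum_3
  using exhaust_3[of k] exhaust_3[of i] exhaust_3[of j]
  by (auto simp: vector_3)

lemma has_vector_derivative_vec_3:
  fixes f :: "real \<Rightarrow> real ^ 3"
  shows "(f has_vector_derivative d) (at t) \<longleftrightarrow>
    ((\<lambda>t. f t $ 1) has_real_derivative d $ 1) (at t) \<and>
    ((\<lambda>t. f t $ 2) has_real_derivative d $ 2) (at t) \<and>
    ((\<lambda>t. f t $ 3) has_real_derivative d $ 3) (at t)" (is "?L \<longleftrightarrow> ?R")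
proof
  assume ?L
  then show ?R
    by (simp add: has_real_derivative_iff_has_vector_derivative
        bounded_linear.has_vector_derivative[OF bounded_linear_vec_nth])
next
  assume R: ?R
  have decomp: "u = u $ 1 *\<^sub>R axis 1 1 + u $ 2 *\<^sub>R axis 2 1 + u $ 3 *\<^sub>R axis 3 1" for u :: "real ^ 3"
    by (simp add: vec_eq_3 axis_def)
  have "((\<lambda>t. f t $ 1 *\<^sub>R axis 1 1 + f t $ 2 *\<^sub>R axis 2 1 + f t $ 3 *\<^sub>R (axis 3 1 :: real ^ 3))
      has_vector_derivative (d $ 1 *\<^sub>R axis 1 1 + d $ 2 *\<^sub>R axis 2 1 + d $ 3 *\<^sub>R axis 3 1)) (at t)"
    using R unfolding has_real_derivative_iff_has_vector_derivative
    by (intro has_vector_derivative_add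
        bounded_linear.has_vector_derivative[OF bounded_linear_scaleR_left]) auto
  then show ?L by (simp flip: decomp)
qed

lemma is_geodesic_S_metric_iff:
  "is_geodesic (S_metric \<epsilon>) I \<gamma> \<gamma>' \<longleftrightarrow> open I \<and> is_interval I \<and> I \<noteq> {} \<and>
    (\<forall>t\<in>I.
      ((\<lambda>t. \<gamma> t $ 1) has_real_derivative \<gamma>' t $ 1) (at t) \<and>
      ((\<lambda>t. \<gamma> t $ 2) has_real_derivative \<gamma>' t $ 2) (at t) \<and>
      ((\<lambda>t. \<gamma> t $ 3) has_real_derivative \<gamma>' t $ 3) (at t) \<and>
      ((\<lambda>t. \<gamma>' t $ 1) has_real_derivative 0) (at t) \<and>
      ((\<lambda>t. \<gamma>' t $ 2) has_real_derivative - \<epsilon> * (\<gamma>' t $ 1)\<^sup>2 * \<gamma> t $ 2) (at t) \<and>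
      ((\<lambda>t. \<gamma>' t $ 3) has_real_derivative 2 * \<epsilon> * \<gamma>' t $ 1 * \<gamma> t $ 2 * \<gamma>' t $ 2) (at t))"
  by (simp add: is_geodesic_def has_vector_derivative_vec_3 sum_3 christoffel_S_metric
      power2_eq_square mult_ac)

text \<open>The explicit formula is anchored at time 0; translating the parameter moves any time of a
  given geodesic there.\<close>

lemma is_geodesic_shift:
  assumes "is_geodesic g I \<gamma> \<gamma>'"
  shows "is_geodesic g ((\<lambda>t. t - s) ` I) (\<lambda>t. \<gamma> (t + s)) (\<lambda>t. \<gamma>' (t + s))"
proof -
  have shift: "((\<lambda>t. f (t + s)) has_vector_derivative d) (at t)"
    if "(f has_vector_derivative d) (at (t + s))" for f :: "real \<Rightarrow> real ^ 'a" and d t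
  proof -
    have "((\<lambda>t. t + s) has_vector_derivative 1) (at t)"
      by (auto intro!: derivative_eq_intros)
    from vector_diff_chain_at[OF this that] show ?thesis by (simp add: o_def)
  qed
  have "is_interval ((\<lambda>t. t - s) ` I)" "open ((\<lambda>t. t - s) ` I)"
    using assms open_translation[of I "- s"] is_interval_translation[of "- s" I]
    by (auto simp: is_geodesic_def)
  then show ?thesis
    using assms unfolding is_geodesic_def by (auto intro!: shift)
qed

section \<open>Explicit geodesics\<close>

text \<open>\<open>C\<close> and \<open>S\<close> are the generalised cosine and sine, the solutions of \<open>u'' = k u\<close> with
  \<open>u 0 = 1\<close>, \<open>u' 0 = 0\<close> and \<open>u 0 = 0\<close>, \<open>u' 0 = 1\<close>; \<open>A\<close> is the integral of \<open>S\<^sup>2\<close> from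
  0. Describing them by their derivatives lets one argument cover the
  trigonometric, linear and hyperbolic cases.\<close>

definition fundamental_system ::
  "real \<Rightarrow> (real \<Rightarrow> real) \<Rightarrow> (real \<Rightarrow> real) \<Rightarrow> (real \<Rightarrow> real) \<Rightarrow> bool" where
  "fundamental_system k C S A \<longleftrightarrow> C 0 = 1 \<and> S 0 = 0 \<and> A 0 = 0 \<and>
     (\<forall>t. (C has_real_derivative k * S t) (at t) \<and> (S has_real_derivative C t) (at t) \<and>
       (A has_real_derivative (S t)\<^sup>2) (at t))"

lemma fundamental_systemD:
  assumes "fundamental_system k C S A"
  shows "C 0 = 1" "S 0 = 0" "A 0 = 0"
    and "(C has_real_derivative k * S t) (at t)"
    and "(S has_real_derivative C t) (at t)"
    and "(A has_real_derivative (S t)\<^sup>2) (at t)"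
  using assms by (auto simp: fundamental_system_def)

lemma zero_derivative_on_interval:
  fixes f :: "real \<Rightarrow> real"
  assumes "is_interval I" "\<And>t. t \<in> I \<Longrightarrow> (f has_real_derivative 0) (at t)" "s \<in> I" "t \<in> I"
  shows "f t = f s"
proof -
  have "\<exists>c. \<forall>t\<in>I. f t = c"
    using assms(1,2)
    by (intro has_field_derivative_zero_constant)
      (auto intro: is_interval_convex has_field_derivative_at_within)
  then show ?thesis using assms(3,4) by auto
qed

lemma fundamental_system_wronskian:
  assumes "fundamental_system k C S A"
  shows "(C t)\<^sup>2 - k * (S t)\<^sup>2 = 1"
proof -
  note F = fundamental_systemD[OF assms]
  have "((\<lambda>t. (C t)\<^sup>2 - k * (S t)\<^sup>2) has_real_derivative 0) (at t)" for t
    by (auto intro!: derivative_eq_intros F)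
  from zero_derivative_on_interval[OF _ this, of UNIV 0 t] show ?thesis
    by (simp add: F)
qed

text \<open>Instead of a general uniqueness theorem for differential equations: \<open>C y - S y'\<close> and
  \<open>C y' - k S y\<close> are constants of motion, equal to \<open>y 0\<close> and \<open>y' 0\<close>, and since
  \<open>C\<^sup>2 - k S\<^sup>2 = 1\<close> the solution can be recovered from them.\<close>

lemma linear_oscillator_unique:
  assumes F: "fundamental_system k C S A" and I: "is_interval I" "0 \<in> I" "t \<in> I"
    and y: "\<And>t. t \<in> I \<Longrightarrow> (y has_real_derivative y' t) (at t)"
    and y': "\<And>t. t \<in> I \<Longrightarrow> (y' has_real_derivative k * y t) (at t)"
  shows "y t = y 0 * C t + y' 0 * S t"
proof -
  note FD = fundamental_systemD[OF F]
  have "((\<lambda>t. C t * y t - S t * y' t) has_real_derivative 0) (at t)" if "t \<in> I" for t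
    by (rule derivative_eq_intros FD y[OF that] y'[OF that] refl)+ (simp add: algebra_simps)
  from zero_derivative_on_interval[OF I(1) this I(2,3)]
  have u: "y 0 = C t * y t - S t * y' t" by (simp add: FD)
  have "((\<lambda>t. C t * y' t - k * S t * y t) has_real_derivative 0) (at t)" if "t \<in> I" for t
    by (rule derivative_eq_intros FD y[OF that] y'[OF that] refl)+ (simp add: algebra_simps)
  from zero_derivative_on_interval[OF I(1) this I(2,3)]
  have v: "y' 0 = C t * y' t - k * S t * y t" by (simp add: FD)
  have "y 0 * C t + y' 0 * S t = ((C t)\<^sup>2 - k * (S t)\<^sup>2) * y t"
    unfolding u v by (simp add: algebra_simps power2_eq_square)
  then show ?thesis by (simp add: fundamental_system_wronskian[OF F])
qed

text \<open>The third component integrates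
  \<open>z' = v $ 3 + \<epsilon> * v $ 1 * (y\<^sup>2 - (P $ 2)\<^sup>2)\<close>. In \<open>y\<^sup>2 - (P $ 2)\<^sup>2\<close> the term
  \<open>C\<^sup>2 - 1\<close> equals \<open>k S\<^sup>2\<close>, and \<open>2 C S\<close> is the derivative of \<open>S\<^sup>2\<close>, so that only \<open>A\<close> and
  \<open>S\<^sup>2\<close> occur in the primitive.\<close>

definition geod ::
  "real \<Rightarrow> (real \<Rightarrow> real) \<Rightarrow> (real \<Rightarrow> real) \<Rightarrow> (real \<Rightarrow> real) \<Rightarrow> real ^ 3 \<Rightarrow> real ^ 3 \<Rightarrow> real \<Rightarrow> real ^ 3"
  where
  "geod \<epsilon> C S A P v t = vector
     [P $ 1 + v $ 1 * t,
      P $ 2 * C t + v $ 2 * S t,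
      P $ 3 + v $ 3 * t + \<epsilon> * v $ 1 *
        (((v $ 2)\<^sup>2 - \<epsilon> * (v $ 1)\<^sup>2 * (P $ 2)\<^sup>2) * A t + P $ 2 * v $ 2 * (S t)\<^sup>2)]"

lemma geod_third_derivative:
  assumes F: "fundamental_system (- \<epsilon> * (v $ 1)\<^sup>2) C S A"
  shows "((\<lambda>t. geod \<epsilon> C S A P v t $ 3) has_real_derivative
    v $ 3 + \<epsilon> * v $ 1 * ((P $ 2 * C t + v $ 2 * S t)\<^sup>2 - (P $ 2)\<^sup>2)) (at t)"
proof -
  note FD = fundamental_systemD[OF F]
  have "(C t)\<^sup>2 = 1 - \<epsilon> * (v $ 1)\<^sup>2 * (S t)\<^sup>2"
    using fundamental_system_wronskian[OF F, of t] by simp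
  then have "(P $ 2 * C t + v $ 2 * S t)\<^sup>2 - (P $ 2)\<^sup>2 =
      ((v $ 2)\<^sup>2 - \<epsilon> * (v $ 1)\<^sup>2 * (P $ 2)\<^sup>2) * (S t)\<^sup>2 + P $ 2 * v $ 2 * (2 * S t * C t)"
    by algebra
  then show ?thesis
    unfolding geod_def vector_3
    by - (rule derivative_eq_intros FD refl | simp)+
qed

lemma geod_is_geodesic:
  assumes F: "fundamental_system (- \<epsilon> * (v $ 1)\<^sup>2) C S A"
  shows "\<exists>\<gamma>'. is_geodesic (S_metric \<epsilon>) UNIV (geod \<epsilon> C S A P v) \<gamma>' \<and> \<gamma>' 0 = v"
proof (intro exI conjI)
  note FD = fundamental_systemD[OF F]
  let ?y = "\<lambda>t. P $ 2 * C t + v $ 2 * S t"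
  let ?y' = "\<lambda>t. P $ 2 * (- \<epsilon> * (v $ 1)\<^sup>2 * S t) + v $ 2 * C t"
  let ?g' = "\<lambda>t. vector [v $ 1, ?y' t, v $ 3 + \<epsilon> * v $ 1 * ((?y t)\<^sup>2 - (P $ 2)\<^sup>2)] :: real ^ 3"
  have y: "(?y has_real_derivative ?y' t) (at t)" for t
    by (rule derivative_eq_intros FD refl | simp)+
  have y': "(?y' has_real_derivative - \<epsilon> * (v $ 1)\<^sup>2 * ?y t) (at t)" for t
    by (rule derivative_eq_intros FD refl)+ (simp add: algebra_simps)
  have z': "((\<lambda>t. v $ 3 + \<epsilon> * v $ 1 * ((?y t)\<^sup>2 - (P $ 2)\<^sup>2)) has_real_derivative
      2 * \<epsilon> * v $ 1 * ?y t * ?y' t) (at t)" for t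
    by (rule derivative_eq_intros y refl)+ simp
  have x: "((\<lambda>t. P $ 1 + v $ 1 * t) has_real_derivative v $ 1) (at t)" for t
    by (auto intro!: derivative_eq_intros)
  show "is_geodesic (S_metric \<epsilon>) UNIV (geod \<epsilon> C S A P v) ?g'"
    unfolding is_geodesic_S_metric_iff
    using x y y' z' geod_third_derivative[OF F]
    by (simp add: geod_def vector_3)
  show "?g' 0 = v" by (simp add: vec_eq_3 vector_3 FD)
qed

text \<open>The quantities \<open>x'\<close> and \<open>z' - \<epsilon> x' y\<^sup>2\<close> are the inner products of the velocity with the
  Killing fields \<open>\<partial>\<^sub>z\<close> and \<open>\<partial>\<^sub>x\<close>, hence constant. Together with the oscillator
  equation for \<open>y\<close> they determine the geodesic from its initial data.\<close>

lemma geodesic_eq_geod: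
  assumes geo: "is_geodesic (S_metric \<epsilon>) I \<gamma> \<gamma>'" and I: "0 \<in> I" "t \<in> I"
    and F: "fundamental_system (- \<epsilon> * (\<gamma>' 0 $ 1)\<^sup>2) C S A"
  shows "\<gamma> t = geod \<epsilon> C S A (\<gamma> 0) (\<gamma>' 0) t"
proof -
  let ?a = "\<gamma>' 0 $ 1"
  note FD = fundamental_systemD[OF F]
  from geo have int: "is_interval I" by (simp add: is_geodesic_def)
  have x: "((\<lambda>t. \<gamma> t $ 1) has_real_derivative \<gamma>' t $ 1) (at t)"
    and y: "((\<lambda>t. \<gamma> t $ 2) has_real_derivative \<gamma>' t $ 2) (at t)"
    and z: "((\<lambda>t. \<gamma> t $ 3) has_real_derivative \<gamma>' t $ 3) (at t)"
    and x': "((\<lambda>t. \<gamma>' t $ 1) has_real_derivative 0) (at t)"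
    and y': "((\<lambda>t. \<gamma>' t $ 2) has_real_derivative - \<epsilon> * (\<gamma>' t $ 1)\<^sup>2 * \<gamma> t $ 2) (at t)"
    and z': "((\<lambda>t. \<gamma>' t $ 3) has_real_derivative 2 * \<epsilon> * \<gamma>' t $ 1 * \<gamma> t $ 2 * \<gamma>' t $ 2) (at t)"
    if "t \<in> I" for t
    using geo that by (auto simp: is_geodesic_S_metric_iff)
  have a: "\<gamma>' t $ 1 = ?a" if "t \<in> I" for t
    using zero_derivative_on_interval[OF int x' I(1) that] .
  have "((\<lambda>t. \<gamma> t $ 1 - ?a * t) has_real_derivative 0) (at t)" if "t \<in> I" for t
    using x[OF that] by (auto intro!: derivative_eq_intros simp: a that)
  from zero_derivative_on_interval[OF int this I]
  have 1: "\<gamma> t $ 1 = \<gamma> 0 $ 1 + ?a * t" by simp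
  have 2: "\<gamma> t $ 2 = \<gamma> 0 $ 2 * C t + \<gamma>' 0 $ 2 * S t" if "t \<in> I" for t
    using linear_oscillator_unique[OF F int I(1) that y] y' a by simp
  have "((\<lambda>t. \<gamma>' t $ 3 - \<epsilon> * ?a * (\<gamma> t $ 2)\<^sup>2) has_real_derivative 0) (at t)" if "t \<in> I" for t
    by (rule derivative_eq_intros y[OF that] z'[OF that] refl)+ (simp add: a that)
  from zero_derivative_on_interval[OF int this I(1)]
  have "\<gamma>' t $ 3 = \<gamma>' 0 $ 3 + \<epsilon> * ?a * ((\<gamma> t $ 2)\<^sup>2 - (\<gamma> 0 $ 2)\<^sup>2)" if "t \<in> I" for t
    using that by (simp add: algebra_simps)
  then have "((\<lambda>t. \<gamma> t $ 3 - geod \<epsilon> C S A (\<gamma> 0) (\<gamma>' 0) t $ 3) has_real_derivative 0) (at t)"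
    if "t \<in> I" for t
    using DERIV_diff[OF z[OF that] geod_third_derivative[OF F, of "\<gamma> 0"]] that by (simp add: 2)
  from zero_derivative_on_interval[OF int this I]
  have "\<gamma> t $ 3 = geod \<epsilon> C S A (\<gamma> 0) (\<gamma>' 0) t $ 3" by (simp add: geod_def vector_3 FD)
  then show ?thesis using 1 2[OF I(2)] by (simp add: vec_eq_3 geod_def vector_3)
qed

lemma exp_rel_S_metric_iff:
  assumes F: "fundamental_system (- \<epsilon> * (v $ 1)\<^sup>2) C S A"
  shows "exp_rel (S_metric \<epsilon>) P v Q \<longleftrightarrow> Q = geod \<epsilon> C S A P v 1"
proof
  assume "exp_rel (S_metric \<epsilon>) P v Q"
  then show "Q = geod \<epsilon> C S A P v 1"
    unfolding exp_rel_def using geodesic_eq_geod F by metis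
next
  have "geod \<epsilon> C S A P v 0 = P"
    by (simp add: geod_def vec_eq_3 vector_3 fundamental_systemD[OF F])
  moreover assume "Q = geod \<epsilon> C S A P v 1"
  ultimately show "exp_rel (S_metric \<epsilon>) P v Q"
    unfolding exp_rel_def using geod_is_geodesic[OF F, of P] UNIV_I by metis
qed

lemma exp_map_S_metric:
  assumes "fundamental_system (- \<epsilon> * (v $ 1)\<^sup>2) C S A"
  shows "exp_map (S_metric \<epsilon>) P v = geod \<epsilon> C S A P v 1"
    and "v \<in> exp_domain (S_metric \<epsilon>) P"
  by (auto simp: exp_map_def exp_domain_def exp_rel_S_metric_iff[OF assms])

section \<open>Trigonometric and hyperbolic fundamental systems\<close>

text \<open>For \<open>k \<noteq> 0\<close> the third function is elementary: \<open>(C S)' = C\<^sup>2 + k S\<^sup>2 = 1 + 2 k S\<^sup>2\<close>, hence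
  \<open>C S - t\<close> is a primitive of \<open>2 k S\<^sup>2\<close>.\<close>

lemma fundamental_systemI:
  assumes "C 0 = 1" "S 0 = 0" "k \<noteq> 0"
    and C: "\<And>t. (C has_real_derivative k * S t) (at t)"
    and S: "\<And>t. (S has_real_derivative C t) (at t)"
  shows "fundamental_system k C S (\<lambda>t. (C t * S t - t) / (2 * k))"
proof -
  have "((\<lambda>t. (C t)\<^sup>2 - k * (S t)\<^sup>2) has_real_derivative 0) (at t)" for t
    by (auto intro!: derivative_eq_intros C S)
  from zero_derivative_on_interval[OF _ this, of UNIV 0]
  have C2: "C t * C t = 1 + k * (S t * S t)" for t
    using assms by (simp add: power2_eq_square algebra_simps)
  have "((\<lambda>t. (C t * S t - t) / (2 * k)) has_real_derivative (S t)\<^sup>2) (at t)" for t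
    by (rule derivative_eq_intros C S refl)+
      (use \<open>k \<noteq> 0\<close> in \<open>auto simp: C2 field_simps power2_eq_square\<close>)
  then show ?thesis using assms by (simp add: fundamental_system_def)
qed

lemma fundamental_system_trig:
  assumes "a \<noteq> 0"
  shows "fundamental_system (- (a\<^sup>2)) (\<lambda>t. cos (a * t)) (\<lambda>t. sin (a * t) / a)
    (\<lambda>t. (cos (a * t) * (sin (a * t) / a) - t) / (2 * - (a\<^sup>2)))"
  using assms
  by (intro fundamental_systemI) (auto intro!: derivative_eq_intros simp: power2_eq_square)

lemma fundamental_system_hyp:
  assumes "a \<noteq> 0"
  shows "fundamental_system (a\<^sup>2) (\<lambda>t. cosh (a * t)) (\<lambda>t. sinh (a * t) / a)
    (\<lambda>t. (cosh (a * t) * (sinh (a * t) / a) - t) / (2 * a\<^sup>2))"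
  using assms
  by (intro fundamental_systemI) (auto intro!: derivative_eq_intros simp: power2_eq_square)

lemma fundamental_system_zero: "fundamental_system 0 (\<lambda>t. 1) (\<lambda>t. t) (\<lambda>t. t ^ 3 / 3)"
  by (auto simp: fundamental_system_def intro!: derivative_eq_intros)

lemma fundamental_system_exists: "\<exists>C S A. fundamental_system k C S A"
proof (cases k "0::real" rule: linorder_cases)
  case less
  then show ?thesis using fundamental_system_trig[of "sqrt (- k)"] by auto
next
  case equal
  then show ?thesis using fundamental_system_zero by auto
next
  case greater
  then show ?thesis using fundamental_system_hyp[of "sqrt k"] by auto
qed

section \<open>Completeness\<close>

lemma geodesically_complete_S_metric: "geodesically_complete (S_metric \<epsilon>)"
  unfolding geodesically_complete_def
proof (intro allI impI)
  fix I \<gamma> \<gamma>'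
  assume geo: "is_geodesic (S_metric \<epsilon>) I \<gamma> \<gamma>'"
  then obtain s where s: "s \<in> I" by (auto simp: is_geodesic_def)
  obtain C S A where F: "fundamental_system (- \<epsilon> * (\<gamma>' s $ 1)\<^sup>2) C S A"
    using fundamental_system_exists by blast
  let ?\<sigma> = "geod \<epsilon> C S A (\<gamma> s) (\<gamma>' s)"
  have agree: "\<gamma> t = ?\<sigma> (t - s)" if "t \<in> I" for t
    using geodesic_eq_geod[OF is_geodesic_shift[OF geo, of s], of "t - s" C S A] s that F
    by (simp add: image_iff)
  obtain \<sigma>' where "is_geodesic (S_metric \<epsilon>) UNIV ?\<sigma> \<sigma>'"
    using geod_is_geodesic[OF F] by blast
  from is_geodesic_shift[OF this, of "- s"]
  have "is_geodesic (S_metric \<epsilon>) UNIV (\<lambda>t. ?\<sigma> (t - s)) (\<lambda>t. \<sigma>' (t - s))"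
    by (simp add: surj_plus_right)
  then show "\<exists>\<sigma> \<sigma>'. is_geodesic (S_metric \<epsilon>) UNIV \<sigma> \<sigma>' \<and> (\<forall>t\<in>I. \<sigma> t = \<gamma> t)"
    using agree by (intro exI conjI ballI) auto
qed

section \<open>Focusing in \<open>\<S>\<^sub>+\<close>\<close>

text \<open>The sine vanishes at time 1 when \<open>v $ 1 = \<pi>\<close>, so the endpoint forgets \<open>v $ 2\<close>.\<close>

lemma exp_map_S_plus_focus:
  assumes "v $ 1 = pi"
  shows "exp_map S_plus P v $ 2 = - P $ 2"
proof -
  have "fundamental_system (- 1 * (v $ 1)\<^sup>2) (\<lambda>t. cos (pi * t)) (\<lambda>t. sin (pi * t) / pi)
    (\<lambda>t. (cos (pi * t) * (sin (pi * t) / pi) - t) / (2 * - (pi\<^sup>2)))"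
    using fundamental_system_trig[of pi] assms by simp
  from exp_map_S_metric(1)[OF this] show ?thesis by (simp add: geod_def vector_3)
qed

lemma exp_map_first: "exp_map (S_metric \<epsilon>) P v $ 1 = P $ 1 + v $ 1"
proof -
  obtain C S A where "fundamental_system (- \<epsilon> * (v $ 1)\<^sup>2) C S A"
    using fundamental_system_exists by blast
  from exp_map_S_metric(1)[OF this] show ?thesis by (simp add: geod_def vector_3)
qed

lemma exp_map_S_plus_not_surj: "exp_map S_plus P ` exp_domain S_plus P \<noteq> UNIV"
proof
  \<comment> \<open>A point off the focal line: its second coordinate differs from \<open>- P $ 2\<close>.\<close>
  let ?Q = "vector [P $ 1 + pi, 1 - P $ 2, 0] :: real ^ 3"
  assume "exp_map S_plus P ` exp_domain S_plus P = UNIV"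
  then obtain v where v: "exp_map S_plus P v = ?Q" by (metis UNIV_I imageE)
  then have "v $ 1 = pi" using exp_map_first[of 1 P v] by (simp add: vector_3)
  from exp_map_S_plus_focus[OF this, of P] show False by (simp add: v vector_3)
qed

section \<open>The exponential map of \<open>\<S>\<^sub>-\<close>\<close>

lemma exp_map_S_minus:
  "exp_map S_minus P = (\<lambda>v. vector
     [P $ 1 + v $ 1,
      P $ 2 * cosh (v $ 1) + v $ 2 * sinhc (v $ 1),
      P $ 3 + v $ 3 - v $ 1 *
        (((v $ 2)\<^sup>2 + (v $ 1)\<^sup>2 * (P $ 2)\<^sup>2) * sinhc_sq_int (v $ 1)
          + P $ 2 * v $ 2 * (sinhc (v $ 1))\<^sup>2)])"
proof
  fix v
  show "exp_map S_minus P v = vector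
     [P $ 1 + v $ 1,
      P $ 2 * cosh (v $ 1) + v $ 2 * sinhc (v $ 1),
      P $ 3 + v $ 3 - v $ 1 *
        (((v $ 2)\<^sup>2 + (v $ 1)\<^sup>2 * (P $ 2)\<^sup>2) * sinhc_sq_int (v $ 1)
          + P $ 2 * v $ 2 * (sinhc (v $ 1))\<^sup>2)]"
  proof (cases "v $ 1 = 0")
    case True
    then have "fundamental_system (- (- 1) * (v $ 1)\<^sup>2) (\<lambda>t. 1) (\<lambda>t. t) (\<lambda>t. t ^ 3 / 3)"
      using fundamental_system_zero by simp
    from exp_map_S_metric(1)[OF this, of P] True show ?thesis
      by (simp add: geod_def sinhc_eq)
  next
    case False
    then have "fundamental_system (- (- 1) * (v $ 1)\<^sup>2)
      (\<lambda>t. cosh (v $ 1 * t)) (\<lambda>t. sinh (v $ 1 * t) / v $ 1)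
      (\<lambda>t. (cosh (v $ 1 * t) * (sinh (v $ 1 * t) / v $ 1) - t) / (2 * (v $ 1)\<^sup>2))"
      using fundamental_system_hyp by simp
    from exp_map_S_metric(1)[OF this, of P] False show ?thesis by (simp add: geod_def sinhc_eq sinhc_sq_int_eq)
  qed
qed

text \<open>The map \<open>v \<mapsto> exp_P v\<close> is triangular: the first coordinate of the endpoint gives
  \<open>v $ 1\<close>, after which the second is affine in \<open>v $ 2\<close> with slope \<open>sinhc (v $ 1) > 0\<close>, and the
  third is affine in \<open>v $ 3\<close> with slope \<open>1\<close>. Solving from the top gives the inverse.\<close>

definition log_S_minus :: "real ^ 3 \<Rightarrow> real ^ 3 \<Rightarrow> real ^ 3" where
  "log_S_minus P q =
     (let a = q $ 1 - P $ 1; b = (q $ 2 - P $ 2 * cosh a) / sinhc a in vector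
       [a, b, q $ 3 - P $ 3
         + a * ((b\<^sup>2 + a\<^sup>2 * (P $ 2)\<^sup>2) * sinhc_sq_int a + P $ 2 * b * (sinhc a)\<^sup>2)])"

lemma sinhc_nonzero: "sinhc a \<noteq> 0"
  using sinhc_pos[of a] by simp

lemma exp_map_log_S_minus: "exp_map S_minus P (log_S_minus P q) = q"
  by (simp add: log_S_minus_def Let_def exp_map_S_minus vec_eq_3 vector_3 sinhc_nonzero)

lemma log_exp_map_S_minus: "log_S_minus P (exp_map S_minus P v) = v"
  by (simp add: log_S_minus_def Let_def exp_map_S_minus vec_eq_3 vector_3 sinhc_nonzero)

lemma smooth_on_log_S_minus: "smooth_on UNIV (log_S_minus P)"
  unfolding log_S_minus_def Let_def by (intro smooth_intros sinhc_nonzero)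

lemma smooth_on_exp_map_S_minus: "smooth_on UNIV (exp_map S_minus P)"
  unfolding exp_map_S_minus by (intro smooth_intros)

lemma diffeomorphism_UNIV_I:
  assumes "smooth_on UNIV f" "smooth_on UNIV h" "\<And>x. h (f x) = x" "\<And>y. f (h y) = y"
  shows "diffeomorphism UNIV UNIV f"
proof -
  have "bij f" using assms(3,4) by (metis bijI')
  moreover have "inv f = h" using assms(3,4) by (metis inv_equality)
  ultimately show ?thesis using assms by (simp add: diffeomorphism_def)
qed

theorem theorem1p3:
  shows "(geodesically_complete S_plus \<and> geodesically_complete S_minus) \<and>
    (\<forall>P. exp_map S_plus P ` exp_domain S_plus P \<noteq> UNIV) \<and>
    (\<forall>P. exp_domain S_minus P = UNIV \<and> diffeomorphism UNIV UNIV (exp_map S_minus P))"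
proof (intro conjI allI)
  show "exp_domain S_minus P = UNIV" for P
    using exp_map_S_metric(2) fundamental_system_exists by blast
  show "diffeomorphism UNIV UNIV (exp_map S_minus P)" for P
    by (rule diffeomorphism_UNIV_I[OF smooth_on_exp_map_S_minus smooth_on_log_S_minus
        log_exp_map_S_minus exp_map_log_S_minus])
qed (rule geodesically_complete_S_metric exp_map_S_plus_not_surj)+

end
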